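(* Let a dumbbell $\overline{r_1r_2}$ and one or more planar rigid bodies $\mathcal{B}_2,\dots,\mathcal{B}_n$ be in a planar relative equilibrium. Then, if one of the two open cones determined by the line through $\overline{r_1r_2}$ and its perpendicular bisector contains one or more of the rigid bodies, the other open cone cannot be empty (i.e. it contains points of the bodies $\mathcal{B}_2,\dots,\mathcal{B}_n$).
   Context: A dumbbell $\overline{r_1r_2}$ is a rigid body consisting of two point masses (with positive masses) at distinct points $\vec r_1,\vec r_2$ of the plane, connected by a massless rod. The other planar rigid bodies $\mathcal{B}_2,\dots,\mathcal{B}_n$ lie in the same plane; each is either a continuous body, i.e. a bounded planar region with positive mass density $\delta(\vec p)$, or a discretized body, i.e. finitely many point masses (positive masses) connected by massless rods (a single point mass is allowed). The mass of these bodies does not meet $\vec r_1$ or $\vec r_2$. All bodies attract each other by Newtonian gravity (inverse-square force between mass elements) and move in the plane. The system is in a planar relative equilibrium (RE) if its motion is an equilibrium in some uniformly rotating coordinate system, i.e. the whole configuration rotates rigidly in the plane with constant angular velocity about the system's center of mass. The line through $\vec r_1,\vec r_2$ and the perpendicular bisector of the segment $\overline{r_1r_2}$ divide the plane into four quadrants. An open cone is the union of two opposite open quadrants (the two lines are excluded); there are two open cones: the union of the open 1st and 3rd quadrants, and the union of the open 2nd and 4th quadrants. A cone contains a rigid body if all points of the body lie in it. *)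

theory Defs
  imports "HOL-Analysis.Analysis"
begin

text \<open>The plane is \<^typ>\<open>complex\<close>, so that \<^term>\<open>cis a * z\<close> is \<^term>\<open>z\<close> rotated
  by the angle \<^term>\<open>a\<close> about the origin.\<close>

text \<open>A body is given by its position in a reference configuration: a set of point masses
  with their masses, or a region with its mass density. Only the values on the given set matter.\<close>

datatype planar_body =
    Discretized "complex set" "complex \<Rightarrow> real"
  | Continuous "complex set" "complex \<Rightarrow> real"

text \<open>The massless rods of a discretized body do not count as points of the body.\<close>

fun points :: "planar_body \<Rightarrow> complex set" where
  "points (Discretized P \<mu>) = P"
| "points (Continuous R \<delta>) = R"

text \<open>A region: a nonempty open connected set together with none, some or all of its boundary
  points. Integrability of the density says that the body has finite mass.\<close>

definition planar_region :: "complex set \<Rightarrow> bool" where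
  "planar_region R \<longleftrightarrow> R \<in> sets lebesgue \<and>
     (\<exists>U. open U \<and> connected U \<and> U \<noteq> {} \<and> U \<subseteq> R \<and> R \<subseteq> closure U)"

fun rigid_body :: "planar_body \<Rightarrow> bool" where
  "rigid_body (Discretized P \<mu>) \<longleftrightarrow> finite P \<and> P \<noteq> {} \<and> (\<forall>p\<in>P. \<mu> p > 0)"
| "rigid_body (Continuous R \<delta>) \<longleftrightarrow> planar_region R \<and> bounded R \<and>
     (\<forall>p\<in>R. \<delta> p > 0) \<and> integrable (lebesgue_on R) \<delta>"

definition is_dumbbell :: "planar_body \<Rightarrow> complex \<Rightarrow> complex \<Rightarrow> bool" where
  "is_dumbbell b r1 r2 \<longleftrightarrow> r1 \<noteq> r2 \<and>
     (\<exists>\<mu>. \<mu> r1 > 0 \<and> \<mu> r2 > 0 \<and> b = Discretized {r1, r2} \<mu>)"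

fun mass_measure :: "planar_body \<Rightarrow> complex measure" where
  "mass_measure (Discretized P \<mu>) = point_measure P (\<lambda>p. ennreal (\<mu> p))"
| "mass_measure (Continuous R \<delta>) = density (lebesgue_on R) (\<lambda>p. ennreal (\<delta> p))"

definition mass :: "planar_body \<Rightarrow> real" where
  "mass b = measure (mass_measure b) (space (mass_measure b))"

definition center_of_mass :: "planar_body \<Rightarrow> complex" where
  "center_of_mass b = (\<integral>p. p \<partial>mass_measure b) /\<^sub>R mass b"

definition moment_of_inertia :: "planar_body \<Rightarrow> real" where
  "moment_of_inertia b = (\<integral>p. (norm (p - center_of_mass b))\<^sup>2 \<partial>mass_measure b)"

definition system_center_of_mass :: "nat set \<Rightarrow> (nat \<Rightarrow> planar_body) \<Rightarrow> complex" where
  "system_center_of_mass I B =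
     (\<Sum>k\<in>I. mass (B k) *\<^sub>R center_of_mass (B k)) /\<^sub>R (\<Sum>k\<in>I. mass (B k))"

text \<open>The attraction exerted on a unit mass at \<^term>\<open>x\<close> by a unit mass at \<^term>\<open>y\<close>,
  with gravitational constant \<^term>\<open>G\<close>.\<close>

definition attraction :: "real \<Rightarrow> complex \<Rightarrow> complex \<Rightarrow> complex" where
  "attraction G x y = (G / norm (y - x) ^ 3) *\<^sub>R (y - x)"

definition planar_cross :: "complex \<Rightarrow> complex \<Rightarrow> real" where
  "planar_cross a b = Re a * Im b - Im a * Re b"

text \<open>The current position of the material point \<^term>\<open>p\<close> of a body whose center of mass
  has moved to \<^term>\<open>x\<close> and which has turned by the angle \<^term>\<open>a\<close>.\<close>

definition place :: "planar_body \<Rightarrow> complex \<Rightarrow> real \<Rightarrow> complex \<Rightarrow> complex" where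
  "place b x a p = x + cis a * (p - center_of_mass b)"

text \<open>The attraction between two bodies is well defined if almost no pair of mass elements
  collides (for point masses: no pair) and the resulting double integral converges absolutely.
  In all of the following, the body \<^term>\<open>b\<close> is in position \<^term>\<open>x\<close>, \<^term>\<open>a\<close> and
  \<^term>\<open>b'\<close> is in position \<^term>\<open>x'\<close>, \<^term>\<open>a'\<close>; the force and the torque act
  on \<^term>\<open>b\<close>, and the torque is taken about its center of mass.\<close>

definition attraction_defined ::
  "real \<Rightarrow> planar_body \<Rightarrow> complex \<Rightarrow> real \<Rightarrow> planar_body \<Rightarrow> complex \<Rightarrow> real \<Rightarrow> bool" where
  "attraction_defined G b x a b' x' a' \<longleftrightarrow>
     (AE (p, q) in mass_measure b \<Otimes>\<^sub>M mass_measure b'. place b x a p \<noteq> place b' x' a' q) \<and>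
     integrable (mass_measure b \<Otimes>\<^sub>M mass_measure b')
       (\<lambda>(p, q). attraction G (place b x a p) (place b' x' a' q))"

definition force ::
  "real \<Rightarrow> planar_body \<Rightarrow> complex \<Rightarrow> real \<Rightarrow> planar_body \<Rightarrow> complex \<Rightarrow> real \<Rightarrow> complex" where
  "force G b x a b' x' a' =
     (\<integral>(p, q). attraction G (place b x a p) (place b' x' a' q)
        \<partial>(mass_measure b \<Otimes>\<^sub>M mass_measure b'))"

definition torque ::
  "real \<Rightarrow> planar_body \<Rightarrow> complex \<Rightarrow> real \<Rightarrow> planar_body \<Rightarrow> complex \<Rightarrow> real \<Rightarrow> real" where
  "torque G b x a b' x' a' =
     (\<integral>(p, q). planar_cross (place b x a p - x) (attraction G (place b x a p) (place b' x' a' q))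
        \<partial>(mass_measure b \<Otimes>\<^sub>M mass_measure b'))"

definition has_second_derivative ::
  "(real \<Rightarrow> 'a::real_normed_vector) \<Rightarrow> (real \<Rightarrow> 'a) \<Rightarrow> bool" where
  "has_second_derivative f f'' \<longleftrightarrow>
     (\<exists>f'. \<forall>t. (f has_vector_derivative f' t) (at t) \<and> (f' has_vector_derivative f'' t) (at t))"

text \<open>The Newton--Euler equations of the bodies \<^term>\<open>B k\<close>, \<^term>\<open>k \<in> I\<close>, where
  \<^term>\<open>X k t\<close> is the center of mass of \<^term>\<open>B k\<close> at time \<^term>\<open>t\<close> and
  \<^term>\<open>\<theta> k t\<close> is its angle of rotation against the reference configuration. The internal
  forces of a rigid body contribute neither a force nor a torque.\<close>

definition newtonian_motion ::
  "real \<Rightarrow> nat set \<Rightarrow> (nat \<Rightarrow> planar_body) \<Rightarrow>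
     (nat \<Rightarrow> real \<Rightarrow> complex) \<Rightarrow> (nat \<Rightarrow> real \<Rightarrow> real) \<Rightarrow> bool" where
  "newtonian_motion G I B X \<theta> \<longleftrightarrow>
     (\<forall>k\<in>I. \<forall>j\<in>I - {k}. \<forall>t.
        attraction_defined G (B k) (X k t) (\<theta> k t) (B j) (X j t) (\<theta> j t)) \<and>
     (\<forall>k\<in>I. \<exists>A. has_second_derivative (X k) A \<and>
        (\<forall>t. mass (B k) *\<^sub>R A t =
           (\<Sum>j\<in>I - {k}. force G (B k) (X k t) (\<theta> k t) (B j) (X j t) (\<theta> j t)))) \<and>
     (\<forall>k\<in>I. \<exists>\<alpha>. has_second_derivative (\<theta> k) \<alpha> \<and>
        (\<forall>t. moment_of_inertia (B k) * \<alpha> t =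
           (\<Sum>j\<in>I - {k}. torque G (B k) (X k t) (\<theta> k t) (B j) (X j t) (\<theta> j t))))"

text \<open>Starting from the reference configuration, all bodies rotate together, with constant
  angular velocity \<^term>\<open>w\<close>, about the center of mass of the system.\<close>

definition relative_equilibrium :: "real \<Rightarrow> nat set \<Rightarrow> (nat \<Rightarrow> planar_body) \<Rightarrow> bool" where
  "relative_equilibrium G I B \<longleftrightarrow>
     (\<exists>w. let C = system_center_of_mass I B in
        newtonian_motion G I B (\<lambda>k t. C + cis (w * t) * (center_of_mass (B k) - C)) (\<lambda>k t. w * t))"

text \<open>In this motion every material point \<^term>\<open>p\<close> is carried by the same rotation.\<close>

lemma place_uniform_rotation:
  "place b (C + cis (w * t) * (center_of_mass b - C)) (w * t) p = C + cis (w * t) * (p - C)"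
  by (simp add: place_def algebra_simps)

text \<open>Coordinates with origin at the midpoint of the dumbbell: the first one vanishes on the
  perpendicular bisector, the second one on the line through the two points.\<close>

definition along :: "complex \<Rightarrow> complex \<Rightarrow> complex \<Rightarrow> real" where
  "along r1 r2 p = (p - midpoint r1 r2) \<bullet> (r2 - r1)"

definition across :: "complex \<Rightarrow> complex \<Rightarrow> complex \<Rightarrow> real" where
  "across r1 r2 p = (p - midpoint r1 r2) \<bullet> (\<i> * (r2 - r1))"

definition cone13 :: "complex \<Rightarrow> complex \<Rightarrow> complex set" where
  "cone13 r1 r2 = {p. along r1 r2 p > 0 \<and> across r1 r2 p > 0} \<union>
                  {p. along r1 r2 p < 0 \<and> across r1 r2 p < 0}"

definition cone24 :: "complex \<Rightarrow> complex \<Rightarrow> complex set" where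
  "cone24 r1 r2 = {p. along r1 r2 p < 0 \<and> across r1 r2 p > 0} \<union>
                  {p. along r1 r2 p > 0 \<and> across r1 r2 p < 0}"

end

theory Submission
  imports Defs
begin

text \<open>The dumbbell turns with constant angular velocity, so the total torque about its center of
  mass \<open>c\<close> vanishes. Weighted by the masses, \<open>r1 - c\<close> and \<open>r2 - c\<close> are opposite multiples of
  \<open>r2 - r1\<close>, hence the torque caused by a unit mass at \<open>q\<close> is a positive multiple of
  \<open>across q * (1/\<bar>q - r2\<bar>^3 - 1/\<bar>q - r1\<bar>^3)\<close>. The second factor has the sign of \<open>along q\<close>, so
  the torque is positive on one open cone, negative on the other, and zero on the two lines.\<close>

section \<open>Coordinates along and across the dumbbell\<close>

lemma in_cone13_iff: "p \<in> cone13 r1 r2 \<longleftrightarrow> along r1 r2 p * across r1 r2 p > 0"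
  by (auto simp: cone13_def zero_less_mult_iff)

lemma in_cone24_iff: "p \<in> cone24 r1 r2 \<longleftrightarrow> along r1 r2 p * across r1 r2 p < 0"
  by (auto simp: cone24_def mult_less_0_iff)

text \<open>Expanding both squares about the midpoint leaves only the mixed terms. This ties the
  side of the perpendicular bisector to which endpoint is nearer.\<close>

lemma along_eq_norm_diff:
  "2 * along r1 r2 q = (norm (q - r1))\<^sup>2 - (norm (q - r2))\<^sup>2"
  unfolding along_def midpoint_def inner_complex_def cmod_power2
  by (simp add: field_simps power2_eq_square)

text \<open>A cross product with \<open>r2 - r1\<close> does not change when the base point moves
  along the line through the endpoints. The attractions at \<open>r1\<close> and \<open>r2\<close>
  point along \<open>q - r1\<close> and \<open>q - r2\<close>, so both base points occur.\<close>

lemma across_eq_planar_cross: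
  "across r1 r2 q = planar_cross (r2 - r1) (q - r1)" "across r1 r2 q = planar_cross (r2 - r1) (q - r2)"
  unfolding across_def midpoint_def inner_complex_def planar_cross_def
  by (simp_all add: field_simps)

text \<open>The nearer endpoint has the larger inverse cube, and \<open>along\<close> is positive
  exactly when \<open>r2\<close> is nearer.\<close>

lemma sgn_inverse_cube_diff:
  assumes "q \<noteq> r1" "q \<noteq> r2"
  shows "sgn (1 / norm (q - r2) ^ 3 - 1 / norm (q - r1) ^ 3) = sgn (along r1 r2 q)"
proof -
  have pos: "norm (q - r1) > 0" "norm (q - r2) > 0"
    using assms by auto
  have *: "1 / b ^ 3 < 1 / a ^ 3 \<and> a\<^sup>2 < b\<^sup>2" if "0 < a" "a < b" for a b :: real
    using that by (simp add: frac_less2 power_strict_mono)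
  consider "norm (q - r1) < norm (q - r2)" | "norm (q - r1) = norm (q - r2)"
    | "norm (q - r2) < norm (q - r1)"
    by linarith
  then show ?thesis
  proof cases
    case 1
    with *[OF pos(1) 1] along_eq_norm_diff[of r1 r2 q]
    have "1 / norm (q - r2) ^ 3 - 1 / norm (q - r1) ^ 3 < 0" "along r1 r2 q < 0" by linarith+
    then show ?thesis by (simp only: sgn_neg)
  next
    case 2
    with along_eq_norm_diff[of r1 r2 q] show ?thesis by simp
  next
    case 3
    with *[OF pos(2) 3] along_eq_norm_diff[of r1 r2 q]
    have "1 / norm (q - r2) ^ 3 - 1 / norm (q - r1) ^ 3 > 0" "along r1 r2 q > 0" by linarith+
    then show ?thesis by (simp only: sgn_pos)
  qed
qed

section \<open>The torque of a unit mass on the dumbbell\<close>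

lemma planar_cross_scaleR:
  "planar_cross (a *\<^sub>R x) y = a * planar_cross x y" "planar_cross x (a *\<^sub>R y) = a * planar_cross x y"
  by (simp_all add: planar_cross_def algebra_simps)

lemma bounded_linear_planar_cross: "bounded_linear (planar_cross a)"
proof -
  have "planar_cross a = (\<lambda>b. Re a * Im b - Im a * Re b)"
    by (simp add: planar_cross_def fun_eq_iff)
  then show ?thesis
    by (simp only:) (intro bounded_linear_sub bounded_linear_const_mult bounded_linear_Re bounded_linear_Im)
qed

text \<open>This is the torque about \<open>c\<close> that a unit mass at \<open>q\<close> exerts on
  the dumbbell; integrated against the mass measure of another body it gives the torque due to that
  body.\<close>

definition dumbbell_torque_kernel ::
  "real \<Rightarrow> (complex \<Rightarrow> real) \<Rightarrow> complex \<Rightarrow> complex \<Rightarrow> complex \<Rightarrow> complex \<Rightarrow> real" where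
  "dumbbell_torque_kernel G \<mu> r1 r2 c q =
     \<mu> r1 * planar_cross (r1 - c) (attraction G r1 q) +
     \<mu> r2 * planar_cross (r2 - c) (attraction G r2 q)"

lemma center_of_mass_dumbbell:
  assumes "r1 \<noteq> r2" "\<mu> r1 > 0" "\<mu> r2 > 0"
  shows "center_of_mass (Discretized {r1, r2} \<mu>) = (\<mu> r1 *\<^sub>R r1 + \<mu> r2 *\<^sub>R r2) /\<^sub>R (\<mu> r1 + \<mu> r2)"
proof -
  have "mass (Discretized {r1, r2} \<mu>) = \<mu> r1 + \<mu> r2"
    using assms unfolding mass_def measure_def
    by (simp add: space_point_measure emeasure_point_measure_finite flip: ennreal_plus)
  then show ?thesis
    using assms unfolding center_of_mass_def
    by (subst mass_measure.simps, subst lebesgue_integral_point_measure_finite) auto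
qed

lemma sgn_dumbbell_torque_kernel:
  assumes "G > 0" "r1 \<noteq> r2" "\<mu> r1 > 0" "\<mu> r2 > 0" "q \<noteq> r1" "q \<noteq> r2"
  shows "sgn (dumbbell_torque_kernel G \<mu> r1 r2 (center_of_mass (Discretized {r1, r2} \<mu>)) q) =
    sgn (along r1 r2 q * across r1 r2 q)"
proof -
  define c where "c = center_of_mass (Discretized {r1, r2} \<mu>)"
  define M where "M = \<mu> r1 + \<mu> r2"
  have M: "M > 0" using assms by (simp add: M_def)
  have "M *\<^sub>R c = \<mu> r1 *\<^sub>R r1 + \<mu> r2 *\<^sub>R r2"
    using M assms by (simp add: c_def center_of_mass_dumbbell M_def)
  then have "M *\<^sub>R (r1 - c) = (- \<mu> r2) *\<^sub>R (r2 - r1)" "M *\<^sub>R (r2 - c) = \<mu> r1 *\<^sub>R (r2 - r1)"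
    by (simp_all add: M_def algebra_simps)
  then have "(1 / M) *\<^sub>R (M *\<^sub>R (r1 - c)) = (- \<mu> r2 / M) *\<^sub>R (r2 - r1)"
    "(1 / M) *\<^sub>R (M *\<^sub>R (r2 - c)) = (\<mu> r1 / M) *\<^sub>R (r2 - r1)"
    by simp_all
  then have c: "r1 - c = (- \<mu> r2 / M) *\<^sub>R (r2 - r1)" "r2 - c = (\<mu> r1 / M) *\<^sub>R (r2 - r1)"
    using M by simp_all
  \<comment> \<open>The two lever arms are opposite: after weighting by the endpoint masses they
    share the reduced mass \<open>\<mu> r1 * \<mu> r2 / M\<close>, so \<open>across\<close> factors
    out and only the difference of inverse cubes remains.\<close>
  have "dumbbell_torque_kernel G \<mu> r1 r2 c q =
    (G * \<mu> r1 * \<mu> r2 / M) * (across r1 r2 q * (1 / norm (q - r2) ^ 3 - 1 / norm (q - r1) ^ 3))"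
    unfolding dumbbell_torque_kernel_def attraction_def c planar_cross_scaleR
      across_eq_planar_cross[symmetric]
    by (simp add: algebra_simps)
  moreover have "G * \<mu> r1 * \<mu> r2 / M > 0" using assms M by simp
  ultimately show ?thesis
    using assms M sgn_inverse_cube_diff[of q r1 r2] unfolding c_def[symmetric]
    by (simp add: sgn_mult mult.commute)
qed

section \<open>Mass measures and integrals over bodies\<close>

lemma space_mass_measure [simp]: "space (mass_measure b) = points b"
  by (cases b) (auto simp: space_point_measure)

lemma mass_measure_Continuous:
  assumes "rigid_body (Continuous R \<delta>)"
  shows "R \<in> sets lebesgue" "(\<lambda>p. ennreal (\<delta> p)) \<in> borel_measurable (lebesgue_on R)"
  using assms by (auto simp: planar_region_def)

text \<open>Supplies the sigma-finiteness required by Fubini. For a continuous body the total mass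
  is the integral of its integrable density.\<close>

lemma finite_measure_mass_measure:
  assumes "rigid_body b"
  shows "finite_measure (mass_measure b)"
proof (cases b)
  case (Discretized P \<mu>)
  with assms show ?thesis
    by (intro finite_measureI)
      (auto simp: space_point_measure emeasure_point_measure_finite ennreal_sum_less_top less_top[symmetric])
next
  case (Continuous R \<delta>)
  note R = mass_measure_Continuous[OF assms[unfolded Continuous]]
  have "integrable (lebesgue_on R) \<delta>" "\<forall>p\<in>R. \<delta> p > 0"
    using assms Continuous by auto
  then have "(\<integral>\<^sup>+p. ennreal (\<delta> p) \<partial>lebesgue_on R) = ennreal (\<integral>p. \<delta> p \<partial>lebesgue_on R)"
    by (intro nn_integral_eq_integral AE_I2) (auto simp: less_imp_le)
  moreover have "emeasure (mass_measure b) R = (\<integral>\<^sup>+p. ennreal (\<delta> p) \<partial>lebesgue_on R)"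
    using R unfolding Continuous mass_measure.simps
    by (subst emeasure_density) (auto intro!: nn_integral_cong sets.top[of "lebesgue_on R", simplified])
  ultimately show ?thesis
    using Continuous by (intro finite_measureI) auto
qed

text \<open>Serves to refute two contradictory properties that both hold almost everywhere on a
  space of positive measure.\<close>

lemma AE_False_iff: "(AE x in M. False) \<longleftrightarrow> emeasure M (space M) = 0"
  by (rule AE_iff_measurable[OF sets.top]) simp

text \<open>A region contains a nonempty open set, so it is not negligible, and a positive density
  cannot vanish almost everywhere on it. A discretized body has at least one positive point
  mass.\<close>

lemma emeasure_mass_measure_points:
  assumes "rigid_body b"
  shows "emeasure (mass_measure b) (points b) \<noteq> 0"
proof (cases b)
  case (Discretized P \<mu>)
  with assms show ?thesis
    by (auto simp: emeasure_point_measure_finite sum_nonneg_eq_0_iff ennreal_eq_0_iff not_le)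
next
  case (Continuous R \<delta>)
  note R = mass_measure_Continuous[OF assms[unfolded Continuous]]
  obtain U where U: "open U" "U \<noteq> {}" "U \<subseteq> R"
    using assms Continuous by (auto simp: planar_region_def)
  have "emeasure lebesgue R \<noteq> 0"
  proof
    assume "emeasure lebesgue R = 0"
    then have "negligible R"
      using R(1) by (simp add: negligible_iff_null_sets null_sets_def)
    then show False
      using U negligible_subset open_not_negligible by blast
  qed
  then have *: "emeasure (lebesgue_on R) R \<noteq> 0"
    using R(1) by (simp add: emeasure_restrict_space)
  show ?thesis
  proof
    assume "emeasure (mass_measure b) (points b) = 0"
    then have "AE p in mass_measure b. False"
      unfolding AE_False_iff by simp
    then have "AE p in lebesgue_on R. \<not> ennreal (\<delta> p) > 0"
      using R(2) unfolding Continuous mass_measure.simps by (simp add: AE_density)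
    moreover have "AE p in lebesgue_on R. \<delta> p > 0"
      using assms Continuous by (intro AE_I2) auto
    ultimately have "AE p in lebesgue_on R. False"
      by eventually_elim simp
    then show False
      using * unfolding AE_False_iff by simp
  qed
qed

text \<open>Fubini with a measure of two atoms as first factor: the double integral becomes a
  weighted sum of two integrals over the other body. The \<open>place\<close> assumptions say that
  both bodies are in their reference position.\<close>

lemma torque_dumbbell:
  assumes "r1 \<noteq> r2" "\<mu> r1 > 0" "\<mu> r2 > 0" "rigid_body b'"
    and place: "place (Discretized {r1, r2} \<mu>) x a = id" "place b' x' a' = id"
    and "attraction_defined G (Discretized {r1, r2} \<mu>) x a b' x' a'"
  shows "integrable (mass_measure b') (dumbbell_torque_kernel G \<mu> r1 r2 x)"
    and "torque G (Discretized {r1, r2} \<mu>) x a b' x' a' =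
      (\<integral>q. dumbbell_torque_kernel G \<mu> r1 r2 x q \<partial>mass_measure b')"
proof -
  define N where "N = point_measure {r1, r2} (\<lambda>p. ennreal (\<mu> p))"
  define M where "M = mass_measure b'"
  interpret M: finite_measure M
    unfolding M_def by (rule finite_measure_mass_measure) fact
  interpret N: finite_measure N
    unfolding N_def
    by (intro finite_measureI)
      (auto simp: space_point_measure emeasure_point_measure_finite)
  interpret NM: pair_sigma_finite N M ..
  have int: "integrable (N \<Otimes>\<^sub>M M) (\<lambda>z. attraction G (fst z) (snd z))"
    using assms(7) unfolding attraction_defined_def place N_def M_def
    by (simp add: case_prod_beta')
  \<comment> \<open>Both atoms have positive weight, so a property that holds almost everywhere for
    \<open>N\<close> holds at \<open>r1\<close> and at \<open>r2\<close>.\<close>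
  have "AE p in N. integrable M (\<lambda>q. attraction G p q)"
    using NM.AE_integrable_fst'[OF int] by simp
  then have attr: "integrable M (attraction G r1)" "integrable M (attraction G r2)"
    using assms(2,3) unfolding N_def by (simp_all add: AE_point_measure)
  show "integrable (mass_measure b') (dumbbell_torque_kernel G \<mu> r1 r2 x)"
    using attr unfolding dumbbell_torque_kernel_def M_def
    by (intro Bochner_Integration.integrable_add integrable_mult_right
        integrable_bounded_linear[OF bounded_linear_planar_cross])
  let ?t = "\<lambda>z. planar_cross (fst z - x) (attraction G (fst z) (snd z))"
  \<comment> \<open>The lever arm depends on the first variable, but is constant on each slice over
    one endpoint. There the integrand is a fixed bounded linear image of the attraction, so its
    integrability follows from \<open>int\<close>.\<close>
  let ?i = "\<lambda>r z. indicator ({r} \<times> space M) z *\<^sub>R planar_cross (r - x) (attraction G (fst z) (snd z))"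
  have "integrable (N \<Otimes>\<^sub>M M) (?i r)" if "r \<in> {r1, r2}" for r
    using that
    by (intro integrable_mult_indicator pair_measureI sets.top
        integrable_bounded_linear[OF bounded_linear_planar_cross] int)
      (auto simp: N_def sets_point_measure)
  then have "integrable (N \<Otimes>\<^sub>M M) (\<lambda>z. ?i r1 z + ?i r2 z)"
    by (intro Bochner_Integration.integrable_add) auto
  moreover have "?i r1 z + ?i r2 z = ?t z" if "z \<in> space (N \<Otimes>\<^sub>M M)" for z
    using that assms(1) by (auto simp: space_pair_measure N_def space_point_measure)
  ultimately have "integrable (N \<Otimes>\<^sub>M M) ?t"
    by (simp cong: Bochner_Integration.integrable_cong)
  then have "(\<integral>z. ?t z \<partial>(N \<Otimes>\<^sub>M M)) = (\<integral>p. (\<integral>q. planar_cross (p - x) (attraction G p q) \<partial>M) \<partial>N)"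
    using NM.integral_fst'[of ?t] by simp
  also have "\<dots> = \<mu> r1 * (\<integral>q. planar_cross (r1 - x) (attraction G r1 q) \<partial>M) +
      \<mu> r2 * (\<integral>q. planar_cross (r2 - x) (attraction G r2 q) \<partial>M)"
    unfolding N_def using assms(1-3) by (subst lebesgue_integral_point_measure_finite) auto
  also have "\<dots> = (\<integral>q. dumbbell_torque_kernel G \<mu> r1 r2 x q \<partial>M)"
    unfolding dumbbell_torque_kernel_def
    using attr[THEN integrable_bounded_linear[OF bounded_linear_planar_cross]]
    by (subst Bochner_Integration.integral_add) auto
  finally show "torque G (Discretized {r1, r2} \<mu>) x a b' x' a' =
      (\<integral>q. dumbbell_torque_kernel G \<mu> r1 r2 x q \<partial>mass_measure b')"
    unfolding torque_def place M_def N_def by (simp add: case_prod_beta')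
qed

section \<open>Torque balance in a relative equilibrium\<close>

lemma has_second_derivative_linear_zero:
  assumes "has_second_derivative (\<lambda>t. w * t) \<alpha>"
  shows "\<alpha> t = (0::real)"
proof -
  obtain f' where f': "((\<lambda>t. w * t) has_vector_derivative f' t) (at t)"
    "(f' has_vector_derivative \<alpha> t) (at t)" for t
    using assms unfolding has_second_derivative_def by blast
  have "((\<lambda>t. w * t) has_vector_derivative w) (at t)" for t
    by (auto intro!: derivative_eq_intros)
  then have "f' = (\<lambda>_. w)"
    using f'(1) vector_derivative_unique_at by blast
  then show ?thesis
    using f'(2)[of t] vector_derivative_unique_at has_vector_derivative_const by blast
qed

text \<open>This is the rotational equation of the dumbbell at time 0, when all bodies are in their
  reference position and \<open>place\<close> is the identity.\<close>

lemma dumbbell_torques_sum_zero: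
  assumes "relative_equilibrium G I B" "k \<in> I" "B k = Discretized {r1, r2} \<mu>"
    and "r1 \<noteq> r2" "\<mu> r1 > 0" "\<mu> r2 > 0" "\<And>j. j \<in> I - {k} \<Longrightarrow> rigid_body (B j)"
  defines "h \<equiv> dumbbell_torque_kernel G \<mu> r1 r2 (center_of_mass (Discretized {r1, r2} \<mu>))"
  shows "\<forall>j\<in>I - {k}. integrable (mass_measure (B j)) h"
    and "(\<Sum>j\<in>I - {k}. \<integral>q. h q \<partial>mass_measure (B j)) = 0"
proof -
  define C where "C = system_center_of_mass I B"
  obtain w where "newtonian_motion G I B
      (\<lambda>k t. C + cis (w * t) * (center_of_mass (B k) - C)) (\<lambda>k t. w * t)"
    using assms(1) unfolding relative_equilibrium_def C_def Let_def by blast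
  note motion = this[unfolded newtonian_motion_def]
  obtain \<alpha> where \<alpha>: "has_second_derivative (\<lambda>t. w * t) \<alpha>"
    "\<And>t. moment_of_inertia (B k) * \<alpha> t =
       (\<Sum>j\<in>I - {k}. torque G (B k) (C + cis (w * t) * (center_of_mass (B k) - C)) (w * t)
          (B j) (C + cis (w * t) * (center_of_mass (B j) - C)) (w * t))"
    using motion assms(2) by blast
  \<comment> \<open>The equations of motion only provide some angular acceleration; uniqueness of
    derivatives forces it to be 0 for the angle \<open>w * t\<close>.\<close>
  have sum0: "(\<Sum>j\<in>I - {k}. torque G (B k) (center_of_mass (B k)) 0 (B j) (center_of_mass (B j)) 0) = 0"
    using \<alpha>(2)[of 0] has_second_derivative_linear_zero[OF \<alpha>(1)] by simp
  have def: "attraction_defined G (B k) (center_of_mass (B k)) 0 (B j) (center_of_mass (B j)) 0"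
    if "j \<in> I - {k}" for j
  proof -
    have "attraction_defined G (B k) (C + cis (w * 0) * (center_of_mass (B k) - C)) (w * 0)
          (B j) (C + cis (w * 0) * (center_of_mass (B j) - C)) (w * 0)"
      using motion assms(2) that by blast
    then show ?thesis by simp
  qed
  have place: "place b (center_of_mass b) 0 = id" for b
    by (simp add: place_def fun_eq_iff)
  note torque = torque_dumbbell[OF assms(4-7) place place def[unfolded assms(3)]]
  show "\<forall>j\<in>I - {k}. integrable (mass_measure (B j)) h"
    unfolding h_def using torque(1) by blast
  show "(\<Sum>j\<in>I - {k}. \<integral>q. h q \<partial>mass_measure (B j)) = 0"
    using sum0 torque(2) unfolding h_def assms(3) by simp
qed

section \<open>The sign contradiction\<close>

lemma integral_mass_measure_pos:
  fixes f :: "complex \<Rightarrow> real"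
  assumes "rigid_body b" "integrable (mass_measure b) f" "\<And>p. p \<in> points b \<Longrightarrow> f p > 0"
  shows "(\<integral>p. f p \<partial>mass_measure b) > 0"
proof -
  have nonneg: "AE p in mass_measure b. 0 \<le> f p"
    using assms(3) by (intro AE_I2) (auto simp: less_imp_le)
  have "(\<integral>p. f p \<partial>mass_measure b) \<noteq> 0"
  proof
    assume "(\<integral>p. f p \<partial>mass_measure b) = 0"
    then have "AE p in mass_measure b. f p = 0"
      using integral_nonneg_eq_0_iff_AE[OF assms(2) nonneg] by simp
    moreover have "AE p in mass_measure b. f p > 0"
      using assms(3) by (intro AE_I2) auto
    ultimately have "AE p in mass_measure b. False"
      by eventually_elim simp
    then show False
      using emeasure_mass_measure_points[OF assms(1)]
      unfolding AE_False_iff by simp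
  qed
  with integral_nonneg_AE[OF nonneg] show ?thesis by simp
qed

text \<open>If the signed product were positive on all of body \<open>i\<close>, this body would
  contribute a strictly positive term to a sum whose other terms are nonnegative, while torque
  balance makes the sum 0. The factor \<open>s\<close> lets one argument treat both cones.\<close>

lemma dumbbell_equilibrium_sign:
  fixes s :: real
  assumes "G > 0" "relative_equilibrium G I B" "finite I" "k \<in> I" "is_dumbbell (B k) r1 r2"
    and rigid: "\<And>j. j \<in> I - {k} \<Longrightarrow> rigid_body (B j)"
    and avoid: "\<And>j. j \<in> I - {k} \<Longrightarrow> r1 \<notin> points (B j) \<and> r2 \<notin> points (B j)"
    and nonneg: "\<And>j p. j \<in> I - {k} \<Longrightarrow> p \<in> points (B j) \<Longrightarrow>
      0 \<le> s * (along r1 r2 p * across r1 r2 p)"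
    and "i \<in> I - {k}"
  shows "\<exists>p\<in>points (B i). s * (along r1 r2 p * across r1 r2 p) \<le> 0"
proof (rule ccontr)
  assume "\<not> ?thesis"
  then have pos: "s * (along r1 r2 p * across r1 r2 p) > 0" if "p \<in> points (B i)" for p
    using that by force
  obtain \<mu> where \<mu>: "r1 \<noteq> r2" "\<mu> r1 > 0" "\<mu> r2 > 0" "B k = Discretized {r1, r2} \<mu>"
    using assms(5) unfolding is_dumbbell_def by blast
  define h where "h = dumbbell_torque_kernel G \<mu> r1 r2 (center_of_mass (Discretized {r1, r2} \<mu>))"
  note zero = dumbbell_torques_sum_zero[OF assms(2,4) \<mu>(4,1-3) rigid, folded h_def]
  \<comment> \<open>The bodies avoid both endpoints, so the sign formula of the kernel applies at
    each of their points.\<close>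
  have sgn: "sgn (s * h p) = sgn (s * (along r1 r2 p * across r1 r2 p))"
    if "j \<in> I - {k}" "p \<in> points (B j)" for j p
  proof -
    have "p \<noteq> r1" "p \<noteq> r2" using avoid[OF that(1)] that(2) by auto
    from sgn_dumbbell_torque_kernel[OF assms(1) \<mu>(1-3) this] show ?thesis
      unfolding h_def sgn_mult[of s] by simp
  qed
  have "0 < (\<Sum>j\<in>I - {k}. \<integral>q. s * h q \<partial>mass_measure (B j))"
  proof (rule sum_pos2[OF _ assms(9)])
    show "0 < (\<integral>q. s * h q \<partial>mass_measure (B i))"
    proof (rule integral_mass_measure_pos)
      show "rigid_body (B i)" "integrable (mass_measure (B i)) (\<lambda>q. s * h q)"
        using rigid zero(1) assms(9) by auto
      show "0 < s * h p" if "p \<in> points (B i)" for p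
        using sgn[OF assms(9) that] pos[OF that] by (metis sgn_greater)
    qed
    show "0 \<le> (\<integral>q. s * h q \<partial>mass_measure (B j))" if "j \<in> I - {k}" for j
    proof (rule Bochner_Integration.integral_nonneg)
      show "0 \<le> s * h p" if "p \<in> space (mass_measure (B j))" for p
        using sgn[OF \<open>j \<in> I - {k}\<close>, of p] nonneg[OF \<open>j \<in> I - {k}\<close>, of p] that
        by (metis sgn_less not_le space_mass_measure)
    qed
  qed (use assms(3) in auto)
  also have "\<dots> = s * (\<Sum>j\<in>I - {k}. \<integral>q. h q \<partial>mass_measure (B j))"
    by (simp add: sum_distrib_left)
  finally show False
    using zero(2) by simp
qed

theorem theorem5p4p2:
  fixes G :: real and n :: nat and B :: "nat \<Rightarrow> planar_body" and r1 r2 :: complex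
  assumes "G > 0"
    and "n \<ge> 2"
    and "is_dumbbell (B 1) r1 r2"
    and "\<And>k. k \<in> {2..n} \<Longrightarrow> rigid_body (B k)"
    and "\<And>k. k \<in> {2..n} \<Longrightarrow> r1 \<notin> points (B k) \<and> r2 \<notin> points (B k)"
    and "relative_equilibrium G {1..n} B"
  shows "((\<exists>k\<in>{2..n}. points (B k) \<subseteq> cone13 r1 r2) \<longrightarrow>
            (\<exists>k\<in>{2..n}. points (B k) \<inter> cone24 r1 r2 \<noteq> {})) \<and>
         ((\<exists>k\<in>{2..n}. points (B k) \<subseteq> cone24 r1 r2) \<longrightarrow>
            (\<exists>k\<in>{2..n}. points (B k) \<inter> cone13 r1 r2 \<noteq> {}))"
proof -
  have others: "{1..n} - {1} = {2..n}" by auto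
  have "1 \<in> {1..n}" using assms(2) by simp
  note sign = dumbbell_equilibrium_sign[OF assms(1,6) finite_atLeastAtMost this assms(3),
      unfolded others, OF assms(4,5)]
  show ?thesis
  proof (intro conjI impI; rule ccontr)
    assume "\<exists>k\<in>{2..n}. points (B k) \<subseteq> cone13 r1 r2"
      and *: "\<not> (\<exists>k\<in>{2..n}. points (B k) \<inter> cone24 r1 r2 \<noteq> {})"
    then obtain i where i: "i \<in> {2..n}" "points (B i) \<subseteq> cone13 r1 r2" by blast
    \<comment> \<open>With \<open>s = 1\<close>, emptiness of the other cone is the nonnegativity
      hypothesis; points on the two lines give 0.\<close>
    have "\<exists>p\<in>points (B i). 1 * (along r1 r2 p * across r1 r2 p) \<le> 0"
      using * by (intro sign i(1)) (auto simp: disjoint_iff in_cone24_iff not_less)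
    with i(2) show False by (force simp: in_cone13_iff)
  next
    assume "\<exists>k\<in>{2..n}. points (B k) \<subseteq> cone24 r1 r2"
      and *: "\<not> (\<exists>k\<in>{2..n}. points (B k) \<inter> cone13 r1 r2 \<noteq> {})"
    then obtain i where i: "i \<in> {2..n}" "points (B i) \<subseteq> cone24 r1 r2" by blast
    \<comment> \<open>Taking \<open>s = -1\<close> exchanges the roles of the cones.\<close>
    have "\<exists>p\<in>points (B i). -1 * (along r1 r2 p * across r1 r2 p) \<le> 0"
      using * by (intro sign i(1)) (auto simp: disjoint_iff in_cone13_iff not_less)
    with i(2) show False by (force simp: in_cone24_iff)
  qed
qed

end
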